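(* Let $X,Y$ be sets, $\mathcal{P}\subseteq\mathcal{P}'(X)$ and $\mathcal{S}\subseteq\mathcal{P}'(Y)$ with $\bigcup\mathcal{P}=X$ and $\bigcup\mathcal{S}=Y$. Let $\mathcal{T}$ (resp. $\mathcal{T}'$) be the topology on $X$ (resp. $Y$) generated by the subbase $\mathcal{P}$ (resp. $\mathcal{S}$), and let $f:X\to Y$ be a map such that $f^{-1}(U)\in\mathcal{P}$ for every $U\in\mathcal{S}$. Let $\mathcal{M}\subseteq\mathcal{P}'(X)$, $\mathcal{M}'=CL(Y,\mathcal{T}')$, $\mathcal{O}=\mathcal{O}_{\mathcal{P}}^{\mathcal{M}}$ and $\mathcal{O}'=\mathcal{O}_{\mathcal{S}}^{\mathcal{M}'}$. Suppose that $(X,\mathcal{T})$ is a $T_2$-space, $(Y,\mathcal{T}')$ is a $T_1$-space, $\mathcal{M}$ is a natural family, and the map $2^f:(\mathcal{M},\mathcal{O})\to(\mathcal{M}',\mathcal{O}')$, defined by $2^f(F)=\overline{f(F)}^Y$ for every $F\in\mathcal{M}$, is a closed map. Then the map $f$ is closed.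
   Context: $\mathcal{P}'(Z)$ denotes the set of all non-empty subsets of a set $Z$; $CL(Y,\mathcal{T}')$ is the set of all non-empty closed subsets of $(Y,\mathcal{T}')$. $\mathcal{M}$ is a natural family in $X$ if $\{x\}\in\mathcal{M}$ for every $x\in X$. For a family $\mathcal{N}\subseteq\mathcal{P}'(Z)$ and $A\subseteq Z$, put $A_{\mathcal{N}}^-=\{N\in\mathcal{N}\mid N\cap A\neq\emptyset\}$; for a cover $\mathcal{U}$ of $Z$ by subsets of $Z$, $\mathcal{O}_{\mathcal{U}}^{\mathcal{N}}$ is the topology on $\mathcal{N}$ having $\{A_{\mathcal{N}}^-\mid A\in\mathcal{U}\}$ as a subbase. A map is closed if it sends closed sets to closed sets. *)

theory Defs
  imports "HOL-Analysis.Analysis"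
begin

definition nonempty_subsets :: "'a set \<Rightarrow> 'a set set" where
  "nonempty_subsets Z = Pow Z - {{}}"

definition closed_hyperspace :: "'a topology \<Rightarrow> 'a set set" where
  "closed_hyperspace T = {C. closedin T C \<and> C \<noteq> {}}"

definition natural_family :: "'a set \<Rightarrow> 'a set set \<Rightarrow> bool" where
  "natural_family X \<M> \<longleftrightarrow> (\<forall>x\<in>X. {x} \<in> \<M>)"

definition hit_sets :: "'a set set \<Rightarrow> 'a set \<Rightarrow> 'a set set" where
  "hit_sets \<N> A = {N \<in> \<N>. N \<inter> A \<noteq> {}}"

text \<open>The library's \<open>topology_generated_by\<close> takes its carrier to be the union of the subbase.
  Here that union is all of \<open>\<N>\<close> as soon as \<open>\<N>\<close> consists of non-empty subsets of \<open>\<Union>\<U>\<close>;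
  see \<open>topspace_hit_topology\<close>.\<close>

definition hit_topology :: "'a set set \<Rightarrow> 'a set set \<Rightarrow> 'a set topology" where
  "hit_topology \<U> \<N> = topology_generated_by {hit_sets \<N> A |A. A \<in> \<U>}"

lemma topspace_hit_topology:
  assumes "\<N> \<subseteq> nonempty_subsets (\<Union>\<U>)"
  shows "topspace (hit_topology \<U> \<N>) = \<N>"
proof -
  have "N \<in> \<Union>{hit_sets \<N> A |A. A \<in> \<U>}" if "N \<in> \<N>" for N
  proof -
    have "N \<subseteq> \<Union>\<U>" "N \<noteq> {}"
      using assms that unfolding nonempty_subsets_def by auto
    then obtain x where "x \<in> N" "x \<in> \<Union>\<U>"
      by (meson ex_in_conv subsetD)
    then obtain A where "A \<in> \<U>" "x \<in> A"
      by auto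
    then have "N \<in> hit_sets \<N> A"
      using that \<open>x \<in> N\<close> unfolding hit_sets_def by auto
    then show ?thesis
      using \<open>A \<in> \<U>\<close> by auto
  qed
  then have "\<Union>{hit_sets \<N> A |A. A \<in> \<U>} = \<N>"
    unfolding hit_sets_def by auto
  then show ?thesis
    unfolding hit_topology_def by simp
qed

definition hyper_map :: "'b topology \<Rightarrow> ('a \<Rightarrow> 'b) \<Rightarrow> 'a set \<Rightarrow> 'b set" where
  "hyper_map T' f F = T' closure_of (f ` F)"

end

theory Submission
  imports Defs
begin

text \<open>
  Singletons embed the base space in its hyperspace: \<open>z \<mapsto> {z}\<close> pulls the subbasic set \<open>hit_sets \<N> A\<close>
  back to \<open>A\<close>. Under this embedding \<open>f\<close> is the restriction of \<open>hyper_map T' f\<close>, because \<open>{f x}\<close> is its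
  own closure in a \<open>T\<^sub>1\<close>-space. Hence \<open>f\<close> is closed as soon as closed sets can be carried from \<open>X\<close> up to
  the hyperspace and back down from the hyperspace of \<open>Y\<close>. Going down only needs continuity of the
  embedding (\<open>continuous_map_singleton_hit_topology\<close>). Going up needs the embedding of \<open>X\<close> to be a
  closed map (\<open>closedin_singletons_hit_topology\<close>), which is where the Hausdorff property enters: two
  distinct points of a set \<open>F\<close> have disjoint neighbourhoods, and hitting enough subbasic sets around
  each of them is a condition that \<open>F\<close> satisfies and no singleton can.
\<close>

text \<open>
  A neighbourhood of a single point \<open>x\<close> of \<open>F\<close> thus yields a neighbourhood of \<open>F\<close>. For a subbasic \<open>U\<close>
  it is the family of sets hitting \<open>U\<close>. For an intersection it is in general larger than the family of
  sets hitting \<open>U\<close>, since a set may hit both parts at different points; only for singletons do the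
  two conditions agree, and this is what makes the induction over the generated topology work.
\<close>

lemma hit_topology_neighbourhood_of_point:
  assumes "openin (topology_generated_by \<U>) U" and "x \<in> U" and "x \<in> F" and "F \<in> \<N>"
  shows "\<exists>W. openin (hit_topology \<U> \<N>) W \<and> F \<in> W \<and> (\<forall>z. {z} \<in> W \<longrightarrow> z \<in> U)"
proof -
  have "generate_topology_on \<U> U"
    using assms(1) by (simp add: openin_topology_generated_by)
  then show ?thesis
    using \<open>x \<in> U\<close>
  proof induction
    case Empty
    then show ?case by simp
  next
    case (Int A B)
    then obtain V W where
      "openin (hit_topology \<U> \<N>) V" "F \<in> V" "\<forall>z. {z} \<in> V \<longrightarrow> z \<in> A"
      "openin (hit_topology \<U> \<N>) W" "F \<in> W" "\<forall>z. {z} \<in> W \<longrightarrow> z \<in> B"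
      by auto
    then show ?case
      by (intro exI[of _ "V \<inter> W"]) auto
  next
    case (UN K)
    then obtain A where "A \<in> K" "x \<in> A"
      by auto
    then obtain W where "openin (hit_topology \<U> \<N>) W" "F \<in> W" "\<forall>z. {z} \<in> W \<longrightarrow> z \<in> A"
      using UN.IH by metis
    then show ?case
      using \<open>A \<in> K\<close> by (intro exI[of _ W]) auto
  next
    case (Basis A)
    then have "openin (hit_topology \<U> \<N>) (hit_sets \<N> A)"
      unfolding hit_topology_def by (intro topology_generated_by_Basis) auto
    moreover have "F \<in> hit_sets \<N> A"
      using Basis assms unfolding hit_sets_def by auto
    moreover have "\<forall>z. {z} \<in> hit_sets \<N> A \<longrightarrow> z \<in> A"
      unfolding hit_sets_def by auto
    ultimately show ?case by blast
  qed
qed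

text \<open>
  A member \<open>F\<close> of the family outside the image of \<open>C\<close> is separated from that image for one of two
  reasons: \<open>F\<close> is a singleton whose point has the complement of \<open>C\<close> as a neighbourhood, or \<open>F\<close> has two
  distinct points and so a neighbourhood without any singletons.
\<close>

lemma closedin_singletons_hit_topology:
  assumes haus: "Hausdorff_space (topology_generated_by \<U>)"
    and sub: "\<N> \<subseteq> nonempty_subsets (\<Union>\<U>)"
    and nat: "natural_family (\<Union>\<U>) \<N>"
    and C: "closedin (topology_generated_by \<U>) C"
  shows "closedin (hit_topology \<U> \<N>) ((\<lambda>x. {x}) ` C)"
proof -
  let ?T = "topology_generated_by \<U>" and ?O = "hit_topology \<U> \<N>" and ?C = "(\<lambda>x. {x}) ` C"
  have "C \<subseteq> \<Union>\<U>"
    using closedin_subset[OF C] by simp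
  then have C_sub: "?C \<subseteq> \<N>"
    using nat unfolding natural_family_def by auto
  have sep: "\<exists>W. openin ?O W \<and> F \<in> W \<and> W \<inter> ?C = {}" if F: "F \<in> \<N> - ?C" for F
  proof -
    have "F \<subseteq> \<Union>\<U>" "F \<noteq> {}"
      using F sub unfolding nonempty_subsets_def by auto
    then obtain x where x: "x \<in> F" "x \<in> \<Union>\<U>"
      by blast
    show ?thesis
    proof (cases "F = {x}")
      case True
      then have "x \<in> topspace ?T - C"
        using x F by auto
      moreover have "openin ?T (topspace ?T - C)"
        using C by blast
      ultimately obtain W where
        "openin ?O W" "F \<in> W" "\<forall>z. {z} \<in> W \<longrightarrow> z \<in> topspace ?T - C"
        using hit_topology_neighbourhood_of_point[of \<U> _ x F \<N>] x F by blast
      then show ?thesis by blast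
    next
      case False
      then obtain y where y: "y \<in> F" "y \<noteq> x"
        using x by blast
      then obtain U V where UV: "openin ?T U" "openin ?T V" "x \<in> U" "y \<in> V" "disjnt U V"
        using haus x \<open>F \<subseteq> \<Union>\<U>\<close> unfolding Hausdorff_space_def topology_generated_by_topspace
        by (metis subsetD)
      obtain W1 where W1: "openin ?O W1" "F \<in> W1" "\<forall>z. {z} \<in> W1 \<longrightarrow> z \<in> U"
        using hit_topology_neighbourhood_of_point[OF UV(1,3) x(1)] F by blast
      obtain W2 where W2: "openin ?O W2" "F \<in> W2" "\<forall>z. {z} \<in> W2 \<longrightarrow> z \<in> V"
        using hit_topology_neighbourhood_of_point[OF UV(2,4) y(1)] F by blast
      have "(W1 \<inter> W2) \<inter> ?C = {}"
        using W1(3) W2(3) UV(5) unfolding disjnt_def by blast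
      then show ?thesis
        using W1 W2 by blast
    qed
  qed
  have "openin ?O (\<N> - ?C)"
  proof (subst openin_subopen, intro ballI)
    fix F assume "F \<in> \<N> - ?C"
    then obtain W where W: "openin ?O W" "F \<in> W" "W \<inter> ?C = {}"
      using sep by meson
    have "W \<subseteq> \<N>"
      using openin_subset[OF W(1)] topspace_hit_topology[OF sub] by simp
    then show "\<exists>W. openin ?O W \<and> F \<in> W \<and> W \<subseteq> \<N> - ?C"
      using W by (intro exI[of _ W]) auto
  qed
  then show ?thesis
    using C_sub topspace_hit_topology[OF sub] by (simp add: closedin_def)
qed

lemma continuous_map_singleton_hit_topology:
  assumes sub: "\<N> \<subseteq> nonempty_subsets (\<Union>\<U>)" and nat: "natural_family (\<Union>\<U>) \<N>"
  shows "continuous_map (topology_generated_by \<U>) (hit_topology \<U> \<N>) (\<lambda>x. {x})"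
  unfolding hit_topology_def
proof (rule continuous_on_generated_topo)
  fix W assume "W \<in> {hit_sets \<N> A |A. A \<in> \<U>}"
  then obtain A where A: "A \<in> \<U>" "W = hit_sets \<N> A"
    by auto
  then have "(\<lambda>x. {x}) -` W \<inter> topspace (topology_generated_by \<U>) = A"
    using nat unfolding hit_sets_def natural_family_def by auto
  then show "openin (topology_generated_by \<U>)
      ((\<lambda>x. {x}) -` W \<inter> topspace (topology_generated_by \<U>))"
    using A by (simp add: topology_generated_by_Basis)
next
  show "(\<lambda>x. {x}) ` topspace (topology_generated_by \<U>) \<subseteq> \<Union>{hit_sets \<N> A |A. A \<in> \<U>}"
    using nat topspace_hit_topology[OF sub]
    unfolding hit_topology_def natural_family_def topology_generated_by_topspace by auto
qed

theorem proposition3p3: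
  fixes X :: "'a set" and Y :: "'b set"
    and \<P> :: "'a set set" and \<S> :: "'b set set"
    and T :: "'a topology" and T' :: "'b topology"
    and f :: "'a \<Rightarrow> 'b"
    and \<M> :: "'a set set" and \<M>' :: "'b set set"
    and \<O> :: "'a set topology" and \<O>' :: "'b set topology"
  assumes "\<P> \<subseteq> nonempty_subsets X" and "\<S> \<subseteq> nonempty_subsets Y"
    and "\<Union>\<P> = X" and "\<Union>\<S> = Y"
    and "T = topology_generated_by \<P>" and "T' = topology_generated_by \<S>"
    and "f \<in> X \<rightarrow> Y"
    and "\<forall>U\<in>\<S>. f -` U \<inter> X \<in> \<P>"
    and "\<M> \<subseteq> nonempty_subsets X" and "\<M>' = closed_hyperspace T'"
    and "\<O> = hit_topology \<P> \<M>" and "\<O>' = hit_topology \<S> \<M>'"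
    and "Hausdorff_space T" and "t1_space T'"
    and "natural_family X \<M>"
    and "closed_map \<O> \<O>' (hyper_map T' f)"
  shows "closed_map T T' f"
proof -
  have topT': "topspace T' = Y"
    using assms(4,6) by simp
  have M'_sub: "\<M>' \<subseteq> nonempty_subsets (\<Union>\<S>)"
    using assms(4,10) topT' closedin_subset
    unfolding closed_hyperspace_def nonempty_subsets_def by fastforce
  have closed_singleton: "closedin T' {y}" if "y \<in> Y" for y
    using \<open>t1_space T'\<close> that topT' by (simp add: t1_space_closedin_singleton)
  have M'_nat: "natural_family (\<Union>\<S>) \<M>'"
    using closed_singleton assms(4,10)
    unfolding natural_family_def closed_hyperspace_def by auto
  show ?thesis
    unfolding closed_map_def
  proof (intro allI impI)
    fix C assume C: "closedin T C"
    have "C \<subseteq> X"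
      using closedin_subset[OF C] assms(3,5) by simp
    then have fC: "f ` C \<subseteq> Y"
      using \<open>f \<in> X \<rightarrow> Y\<close> by auto
    have "closedin \<O> ((\<lambda>x. {x}) ` C)"
      using closedin_singletons_hit_topology[of \<P> \<M> C] assms(3,5,9,11,13,15) C by simp
    then have "closedin \<O>' (hyper_map T' f ` (\<lambda>x. {x}) ` C)"
      using assms(16) unfolding closed_map_def by blast
    moreover have "hyper_map T' f {x} = {f x}" if "x \<in> C" for x
      using closed_singleton[of "f x"] fC that
      unfolding hyper_map_def by (simp add: closure_of_closedin image_subset_iff)
    then have "hyper_map T' f ` (\<lambda>x. {x}) ` C = (\<lambda>y. {y}) ` f ` C"
      by (simp add: image_image)
    ultimately have "closedin \<O>' ((\<lambda>y. {y}) ` f ` C)"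
      by simp
    moreover have "continuous_map T' \<O>' (\<lambda>y. {y})"
      using continuous_map_singleton_hit_topology[OF M'_sub M'_nat] assms(6,12) by simp
    ultimately have "closedin T' {y \<in> topspace T'. {y} \<in> (\<lambda>y. {y}) ` f ` C}"
      by (rule closedin_continuous_map_preimage[rotated])
    moreover have "{y \<in> topspace T'. {y} \<in> (\<lambda>y. {y}) ` f ` C} = f ` C"
      using fC topT' by auto
    ultimately show "closedin T' (f ` C)"
      by simp
  qed
qed

end
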